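(* Consider the optimal control problem $$\min_u\int_0^T\tfrac12\left(u_1(t)^2+u_2(t)^2\right)dt\quad\text{subject to}\quad \begin{cases}\dot{\mathbf{x}}=-\sum_{i=1}^2\mathbf{A}_i(\varphi)\,u_i,\\ \dot\varphi_1=u_1,\quad\dot\varphi_2=u_2,\\ \mathbf{x}(0)\text{ and }\mathbf{x}(T)\text{ fixed},\\ \varphi(0)=\varphi(T)\text{ fixed},\end{cases}$$ for curves $(\varphi(t),\mathbf{x}(t))$ in $S\times\mathbb{R}^2$, $S=\mathbb{S}^1\times\mathbb{S}^1$, where $$\mathbf{A}_1(\varphi)=\mathbf{A}_2(\varphi)=\frac{r\rho}{2h}\begin{bmatrix}\sin(c(\varphi_1-\varphi_2))\\-\cos(c(\varphi_1-\varphi_2))\end{bmatrix}.$$ This optimal control problem is completely integrable. Particularly, if the condition $a-2(\sqrt{H}-\sigma_1)>0$ is satisfied, then its solution $(\varphi(t),\mathbf{x}(t))$ is obtained by quadrature using a solution $\vartheta(t)$ of the nonlinear pendulum equation $$\left(\frac{d\vartheta}{dt}\right)^2=c^2\left(a^2+4(H-\sigma_1^2)+4a\sqrt{H}\cos\vartheta\right).$$ (The constants $a$, $H$, $\sigma_1$ and the variable $\vartheta$ are defined in the context.)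
   Context: The problem models a spherical robot rolling on a plane, driven by two internal wheels with angles $\varphi=(\varphi_1,\varphi_2)$; $\mathbf{x}$ is the position of the center of the sphere. The physical constants are: $r$ the radius of the sphere, $\rho$ the radius of the wheels, $2w$ the track width, $h$ the distance from the center of the sphere to the horizontal plane through the wheels' contact points, $I_{\rm s}$ and $J$ the moments of inertia of the sphere and of the internal unit, and $c=\frac{\rho I_{\rm s}}{2w(I_{\rm s}+J)}$. With $q=(\varphi,\mathbf{x})$ and costate $p=(\gamma,\mathbf{p})$, $\gamma=(\gamma_1,\gamma_2)$, $\mathbf{p}=(p_1,p_2)$, the Pontryagin Maximum Principle gives the optimal control $u_i^\star=\gamma_i-\mathbf{p}\cdot\mathbf{A}_i(\varphi)$ and the Hamiltonian $H(q,p)=\frac12\sum_{i=1}^2(\gamma_i-\mathbf{p}\cdot\mathbf{A}_i(\varphi))^2$ on $T^*(S\times\mathbb{R}^2)$; an optimal solution necessarily satisfies Hamilton's equations $\dot q=\partial H/\partial p$, $\dot p=-\partial H/\partial q$. Complete integrability means that this Hamiltonian system, with 8-dimensional phase space, has four independent first integrals in involution with respect to the canonical Poisson bracket $\{F,G\}=\frac{\partial F}{\partial q}\cdot\frac{\partial G}{\partial p}-\frac{\partial G}{\partial q}\cdot\frac{\partial F}{\partial p}$ (here $H$, $\gamma_1+\gamma_2$, $p_1$, $p_2$). The quantities $H$, $\mathbf{p}$, $\sigma_1=\frac{\gamma_1+\gamma_2}{2}$ and $a=\frac{r\rho}{h}|\mathbf{p}|$ are constant along solutions. Put $\phi_1=\varphi_1+\varphi_2$,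 $\phi_2=\varphi_1-\varphi_2$ and define $\theta$ by $u_1^\star+u_2^\star=2\sqrt{H}\cos\theta$, $u_1^\star-u_2^\star=2\sqrt{H}\sin\theta$, so that $\dot\phi_1=2\sqrt{H}\cos\theta$ and $\dot\phi_2=2\sqrt{H}\sin\theta$. Assuming $\theta\in(-\pi,\pi)$, the pendulum variable $\vartheta\in(-\pi,\pi)$ is defined by $\tan(\vartheta/2)=\sqrt{\frac{a+2(\sqrt{H}+\sigma_1)}{a-2(\sqrt{H}-\sigma_1)}}\,\tan(\theta/2)$; the quadratures are the integrations of the equations for $\dot\phi_1,\dot\phi_2$ and for $\dot{\mathbf{x}}$ after $\theta$ is recovered from $\vartheta$. *)

theory Defs
  imports "HOL-Analysis.Analysis"
begin

section \<open>Canonical Hamiltonian systems on \<open>'a \<times> 'a\<close>\<close>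

text \<open>
  A phase point is a pair \<open>(q, p)\<close>; if \<open>q\<close> ranges over a Euclidean space of dimension \<open>n\<close>, the
  phase space has dimension \<open>2 n\<close>. The partial gradients below are the usual ones wherever the
  function is differentiable.
\<close>

definition grad_q :: "('a::euclidean_space \<times> 'a \<Rightarrow> real) \<Rightarrow> 'a \<times> 'a \<Rightarrow> 'a" where
  "grad_q F z = (\<Sum>b\<in>Basis. frechet_derivative F (at z) (b, 0) *\<^sub>R b)"

definition grad_p :: "('a::euclidean_space \<times> 'a \<Rightarrow> real) \<Rightarrow> 'a \<times> 'a \<Rightarrow> 'a" where
  "grad_p F z = (\<Sum>b\<in>Basis. frechet_derivative F (at z) (0, b) *\<^sub>R b)"

definition poisson_bracket ::
    "('a::euclidean_space \<times> 'a \<Rightarrow> real) \<Rightarrow> ('a \<times> 'a \<Rightarrow> real) \<Rightarrow> 'a \<times> 'a \<Rightarrow> real" where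
  "poisson_bracket F G z = grad_q F z \<bullet> grad_p G z - grad_q G z \<bullet> grad_p F z"

definition hamilton_solution ::
    "('a::euclidean_space \<times> 'a \<Rightarrow> real) \<Rightarrow> real set \<Rightarrow> (real \<Rightarrow> 'a \<times> 'a) \<Rightarrow> bool" where
  "hamilton_solution H I z \<longleftrightarrow>
     (\<forall>t\<in>I. (z has_vector_derivative (grad_p H (z t), - grad_q H (z t))) (at t within I))"

definition first_integral ::
    "('a::euclidean_space \<times> 'a \<Rightarrow> real) \<Rightarrow> ('a \<times> 'a \<Rightarrow> real) \<Rightarrow> bool" where
  "first_integral H F \<longleftrightarrow>
     (\<forall>t0 t1 z. hamilton_solution H {t0..t1} z \<longrightarrow> (\<forall>t\<in>{t0..t1}. F (z t) = F (z t0)))"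

definition cont_diff :: "('b::euclidean_space \<Rightarrow> real) \<Rightarrow> bool" where
  "cont_diff F \<longleftrightarrow> (\<forall>z. F differentiable (at z)) \<and>
     (\<forall>v. continuous_on UNIV (\<lambda>z. frechet_derivative F (at z) v))"

text \<open>Independence of first integrals: the differentials are linearly independent on an open
  dense set.\<close>

definition functionally_independent :: "('b::euclidean_space \<Rightarrow> real) list \<Rightarrow> bool" where
  "functionally_independent Fs \<longleftrightarrow>
     (\<exists>U. open U \<and> closure U = UNIV \<and>
        (\<forall>z\<in>U. \<forall>k :: nat \<Rightarrow> real.
           (\<forall>v. (\<Sum>i<length Fs. k i * frechet_derivative (Fs ! i) (at z) v) = 0) \<longrightarrow>
           (\<forall>i<length Fs. k i = 0)))"

definition completely_integrable_by ::
    "('a::euclidean_space \<times> 'a \<Rightarrow> real) \<Rightarrow> ('a \<times> 'a \<Rightarrow> real) list \<Rightarrow> bool" where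
  "completely_integrable_by H Fs \<longleftrightarrow>
     length Fs = DIM('a) \<and>
     (\<forall>F\<in>set Fs. cont_diff F \<and> first_integral H F) \<and>
     (\<forall>F\<in>set Fs. \<forall>G\<in>set Fs. \<forall>z. poisson_bracket F G z = 0) \<and>
     functionally_independent Fs"


section \<open>The optimal control problem\<close>

text \<open>
  The fields \<open>A i\<close> of the rolling sphere need not be \<open>2 pi\<close>-periodic in the angles, so a curve in
  \<open>S = S^1 \<times> S^1\<close> is represented by a continuous lift \<open>\<phi>\<close> to the universal cover \<open>real ^ 2\<close>
  starting at a prescribed lift \<open>\<phi>0\<close> of the initial point; \<open>\<phi> T\<close> and \<open>\<phi>0\<close> are required to be the
  same point of \<open>S\<close>, i.e. to agree componentwise under \<open>cis\<close>.

  Controls are square integrable and the state equations are required in the Caratheodory sense,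
  i.e. in their integrated form.
\<close>

type_synonym fields = "2 \<Rightarrow> real ^ 2 \<Rightarrow> real ^ 2"

definition ocp_admissible :: "fields \<Rightarrow> real \<Rightarrow> real ^ 2 \<Rightarrow> real ^ 2 \<Rightarrow> real ^ 2 \<Rightarrow>
    (real \<Rightarrow> real ^ 2) \<Rightarrow> (real \<Rightarrow> real ^ 2) \<Rightarrow> (real \<Rightarrow> real ^ 2) \<Rightarrow> bool" where
  "ocp_admissible A T \<phi>0 x0 xT u \<phi> x \<longleftrightarrow>
     u absolutely_integrable_on {0..T} \<and>
     (\<lambda>t. (u t $ 1)\<^sup>2 + (u t $ 2)\<^sup>2) integrable_on {0..T} \<and>
     (\<forall>t\<in>{0..T}. (u has_integral (\<phi> t - \<phi> 0)) {0..t}) \<and>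
     (\<forall>t\<in>{0..T}. ((\<lambda>s. - (\<Sum>i\<in>UNIV. (u s $ i) *\<^sub>R A i (\<phi> s))) has_integral (x t - x 0)) {0..t}) \<and>
     x 0 = x0 \<and> x T = xT \<and>
     \<phi> 0 = \<phi>0 \<and> (\<forall>i. cis (\<phi> T $ i) = cis (\<phi>0 $ i))"

definition ocp_cost :: "real \<Rightarrow> (real \<Rightarrow> real ^ 2) \<Rightarrow> real" where
  "ocp_cost T u = integral {0..T} (\<lambda>t. 1 / 2 * ((u t $ 1)\<^sup>2 + (u t $ 2)\<^sup>2))"

definition ocp_optimal :: "fields \<Rightarrow> real \<Rightarrow> real ^ 2 \<Rightarrow> real ^ 2 \<Rightarrow> real ^ 2 \<Rightarrow>
    (real \<Rightarrow> real ^ 2) \<Rightarrow> (real \<Rightarrow> real ^ 2) \<Rightarrow> (real \<Rightarrow> real ^ 2) \<Rightarrow> bool" where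
  "ocp_optimal A T \<phi>0 x0 xT u \<phi> x \<longleftrightarrow>
     ocp_admissible A T \<phi>0 x0 xT u \<phi> x \<and>
     (\<forall>u' \<phi>' x'. ocp_admissible A T \<phi>0 x0 xT u' \<phi>' x' \<longrightarrow> ocp_cost T u \<le> ocp_cost T u')"

text \<open>
  The phase space is the set of all \<open>((\<phi>, x), (\<gamma>, p))\<close>, of dimension 8. The optimal control
  \<open>u_star\<close> maximises \<open>\<gamma> \<bullet> u - p \<bullet> (\<Sum>i. u_i A_i \<phi>) - |u|^2 / 2\<close> over \<open>u\<close>, and \<open>pmp_hamiltonian\<close>
  is the maximum.
\<close>

type_synonym config = "(real ^ 2) \<times> (real ^ 2)"

definition u_star :: "fields \<Rightarrow> config \<times> config \<Rightarrow> 2 \<Rightarrow> real" where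
  "u_star A = (\<lambda>((\<phi>, x), (\<gamma>, p)) i. \<gamma> $ i - p \<bullet> A i \<phi>)"

definition pmp_hamiltonian :: "fields \<Rightarrow> config \<times> config \<Rightarrow> real" where
  "pmp_hamiltonian A z = 1 / 2 * (\<Sum>i\<in>UNIV. (u_star A z i)\<^sup>2)"


section \<open>The rolling sphere\<close>

definition sphere_fields :: "real \<Rightarrow> real \<Rightarrow> real \<Rightarrow> real \<Rightarrow> fields" where
  "sphere_fields r \<rho> h c i \<phi> =
     (r * \<rho> / (2 * h)) *\<^sub>R vector [sin (c * (\<phi> $ 1 - \<phi> $ 2)), - cos (c * (\<phi> $ 1 - \<phi> $ 2))]"

text \<open>The factor relating \<open>tan (\<theta> / 2)\<close> to \<open>tan (\<psi> / 2)\<close>; \<open>E\<close> is the value of the Hamiltonian.\<close>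

definition half_angle_factor :: "real \<Rightarrow> real \<Rightarrow> real \<Rightarrow> real" where
  "half_angle_factor a E \<sigma> = sqrt ((a + 2 * (sqrt E + \<sigma>)) / (a - 2 * (sqrt E - \<sigma>)))"

text \<open>The angle \<open>\<theta>\<close> in the interval \<open>(- pi, pi)\<close>, recovered from the pendulum variable \<open>\<psi>\<close>.\<close>

definition theta_of_pendulum :: "real \<Rightarrow> real \<Rightarrow> real \<Rightarrow> real \<Rightarrow> real" where
  "theta_of_pendulum a E \<sigma> \<psi> = 2 * arctan (tan (\<psi> / 2) / half_angle_factor a E \<sigma>)"

end

theory Submission
  imports Defs
begin

text \<open>
  Put \<open>s = p \<bullet> A\<^sub>1 \<phi>\<close> and let \<open>m\<close> be its derivative with respect to the phase \<open>c (\<phi>\<^sub>1 - \<phi>\<^sub>2)\<close>. Since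
  the fields depend on \<open>\<phi>\<^sub>1 - \<phi>\<^sub>2\<close> only, \<open>\<gamma>\<^sub>1 + \<gamma>\<^sub>2\<close> and \<open>p\<close> are conserved, and the differentials are
  independent wherever \<open>u\<^sub>1 - u\<^sub>2 = \<gamma>\<^sub>1 - \<gamma>\<^sub>2\<close> is nonzero. Hamilton's equations give \<open>\<theta>' = 2 c m\<close>, while
  \<open>s = \<sigma> - sqrt E cos \<theta>\<close> and \<open>m\<^sup>2 + s\<^sup>2 = a\<^sup>2 / 4\<close>; hence \<open>\<theta>'\<^sup>2 = c\<^sup>2 (a\<^sup>2 - 4 (\<sigma> - sqrt E cos \<theta>)\<^sup>2)\<close>, and
  the half-angle substitution turns this into the pendulum equation.
\<close>

section \<open>Gradients and first integrals\<close>

text \<open>Derivatives are unique, and expansion in an orthonormal basis recovers the vector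
  representing a linear functional. From here on a function is handled through such a vector instead
  of through \<open>frechet_derivative\<close>.\<close>

lemma grad_q_eq:
  assumes "(F has_derivative (\<lambda>v. g \<bullet> v)) (at z)"
  shows "grad_q F z = fst g"
  using frechet_derivative_at[OF assms, symmetric]
  by (cases g) (simp add: grad_q_def euclidean_representation)

lemma grad_p_eq:
  assumes "(F has_derivative (\<lambda>v. g \<bullet> v)) (at z)"
  shows "grad_p F z = snd g"
  using frechet_derivative_at[OF assms, symmetric]
  by (cases g) (simp add: grad_p_def euclidean_representation)

lemma poisson_bracket_eq:
  assumes "(F has_derivative (\<lambda>v. f \<bullet> v)) (at z)" "(G has_derivative (\<lambda>v. g \<bullet> v)) (at z)"
  shows "poisson_bracket F G z = fst f \<bullet> snd g - fst g \<bullet> snd f"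
  by (simp add: poisson_bracket_def assms[THEN grad_q_eq] assms[THEN grad_p_eq])

lemma cont_diff_if_gradient:
  assumes "\<And>z. (F has_derivative (\<lambda>v. g z \<bullet> v)) (at z)" "continuous_on UNIV g"
  shows "cont_diff F"
proof -
  have "frechet_derivative F (at z) = (\<lambda>v. g z \<bullet> v)" for z
    using frechet_derivative_at[OF assms(1)] by simp
  then show ?thesis
    unfolding cont_diff_def
    using assms by (auto simp: differentiable_def intro!: continuous_intros)
qed

text \<open>Along a solution, the derivative of \<open>F\<close> is its bracket with the Hamiltonian.\<close>

lemma first_integral_if_gradient:
  assumes F: "\<And>z. (F has_derivative (\<lambda>v. f z \<bullet> v)) (at z)"
    and H: "\<And>z. (H has_derivative (\<lambda>v. g z \<bullet> v)) (at z)"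
    and 0: "\<And>z. poisson_bracket F H z = 0"
  shows "first_integral H F"
  unfolding first_integral_def
proof (intro allI impI ballI)
  fix t0 t1 t :: real and z
  assume z: "hamilton_solution H {t0..t1} z" and t: "t \<in> {t0..t1}"
  have "((\<lambda>s. F (z s)) has_derivative (\<lambda>h. 0)) (at s within {t0..t1})" if "s \<in> {t0..t1}" for s
  proof -
    have "(z has_derivative (\<lambda>h. h *\<^sub>R (snd (g (z s)), - fst (g (z s))))) (at s within {t0..t1})"
      using z that unfolding hamilton_solution_def has_vector_derivative_def
      by (simp add: grad_q_eq[OF H] grad_p_eq[OF H])
    from has_derivative_compose[OF this F]
    have "((\<lambda>s. F (z s)) has_derivative
        (\<lambda>h. f (z s) \<bullet> (h *\<^sub>R (snd (g (z s)), - fst (g (z s)))))) (at s within {t0..t1})" .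
    \<comment> \<open>Pairing the gradient of \<open>F\<close> with the Hamiltonian vector field is
      exactly the bracket of \<open>F\<close> and \<open>H\<close>.\<close>
    moreover have "f (z s) \<bullet> (snd (g (z s)), - fst (g (z s))) = 0"
      using 0[of "z s"] unfolding poisson_bracket_eq[OF F H]
      by (cases "f (z s)") (simp add: inner_commute)
    ultimately show ?thesis by (simp only: inner_scaleR_right) simp
  qed
  then obtain k where "\<And>s. s \<in> {t0..t1} \<Longrightarrow> F (z s) = k"
    using has_derivative_zero_constant[of "{t0..t1}" "\<lambda>s. F (z s)"] by auto
  then show "F (z t) = F (z t0)" using t by simp
qed

lemma first_integralD:
  assumes "first_integral H F" "hamilton_solution H {t0..t1} z" "t \<in> {t0..t1}"
  shows "F (z t) = F (z t0)"
  using assms unfolding first_integral_def by blast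


section \<open>The Hamiltonian of the rolling sphere\<close>

text \<open>The derivative of \<open>p \<bullet> A i \<phi>\<close> with respect to the phase \<open>c * (\<phi> $ 1 - \<phi> $ 2)\<close>.\<close>

definition dot_sphere_fields' :: "real \<Rightarrow> real \<Rightarrow> real \<Rightarrow> real \<Rightarrow> real ^ 2 \<Rightarrow> real ^ 2 \<Rightarrow> real" where
  "dot_sphere_fields' r \<rho> h c \<phi> p = r * \<rho> / (2 * h) *
     (p $ 1 * cos (c * (\<phi> $ 1 - \<phi> $ 2)) + p $ 2 * sin (c * (\<phi> $ 1 - \<phi> $ 2)))"

text \<open>The two angle entries are opposite because the angles enter only through their
  difference; the entry for \<open>x\<close> vanishes because \<open>x\<close> is cyclic;
  \<open>A 1\<close> serves for both fields, which coincide.\<close>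

definition sphere_gradient ::
    "real \<Rightarrow> real \<Rightarrow> real \<Rightarrow> real \<Rightarrow> config \<times> config \<Rightarrow> config \<times> config" where
  "sphere_gradient r \<rho> h c = (\<lambda>((\<phi>, x), (\<gamma>, p)).
     let A = sphere_fields r \<rho> h c;
         u = u_star A ((\<phi>, x), (\<gamma>, p)); m = c * dot_sphere_fields' r \<rho> h c \<phi> p * (u 1 + u 2)
     in ((vector [- m, m], 0), (vector [u 1, u 2], - (u 1 + u 2) *\<^sub>R A 1 \<phi>)))"

lemma dot_sphere_fields:
  "p \<bullet> sphere_fields r \<rho> h c i \<phi> = r * \<rho> / (2 * h) *
     (p $ 1 * sin (c * (\<phi> $ 1 - \<phi> $ 2)) - p $ 2 * cos (c * (\<phi> $ 1 - \<phi> $ 2)))"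
  by (simp add: sphere_fields_def inner_vec_def sum_2 algebra_simps)

lemma norm_vec2_squared: "(norm (v :: real ^ 2))\<^sup>2 = (v $ 1)\<^sup>2 + (v $ 2)\<^sup>2"
  unfolding power2_norm_eq_inner by (simp add: inner_vec_def sum_2 power2_eq_square)

text \<open>Up to the factor \<open>r * \<rho> / (2 * h)\<close>, the two quantities are the
  coordinates of an orthogonal image of \<open>p\<close>, so their squares add up to a multiple of
  \<open>(norm p)\<^sup>2\<close>.\<close>

lemma dot_sphere_fields_squares:
  "(dot_sphere_fields' r \<rho> h c \<phi> p)\<^sup>2 + (p \<bullet> sphere_fields r \<rho> h c i \<phi>)\<^sup>2
     = (r * \<rho> / h * norm p)\<^sup>2 / 4"
proof -
  define s where "s = sin (c * (\<phi> $ 1 - \<phi> $ 2))"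
  define k where "k = cos (c * (\<phi> $ 1 - \<phi> $ 2))"
  have "s\<^sup>2 + k\<^sup>2 = 1" by (simp add: s_def k_def)
  then have "(p $ 1 * k + p $ 2 * s)\<^sup>2 + (p $ 1 * s - p $ 2 * k)\<^sup>2 = (norm p)\<^sup>2"
    unfolding norm_vec2_squared by algebra
  moreover have "(r * \<rho> / (2 * h) * X)\<^sup>2 + (r * \<rho> / (2 * h) * Y)\<^sup>2
      = (r * \<rho> / h)\<^sup>2 * (X\<^sup>2 + Y\<^sup>2) / 4" for X Y
    \<comment> \<open>For \<open>h = 0\<close>, division by zero makes both sides 0.\<close>
    by (cases "h = 0") (simp_all add: power2_eq_square field_simps)
  ultimately show ?thesis
    unfolding dot_sphere_fields dot_sphere_fields'_def s_def[symmetric] k_def[symmetric]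
    by (simp only: power_mult_distrib[of "r * \<rho> / h" "norm p"])
qed

lemma has_derivative_vec_nth [derivative_intros]:
  "(f has_derivative f') F \<Longrightarrow> ((\<lambda>x. f x $ i) has_derivative (\<lambda>x. f' x $ i)) F"
  by (rule bounded_linear.has_derivative[OF bounded_linear_vec_nth])

text \<open>As the fields coincide, both controls subtract the same scalar \<open>S\<close> from
  their costate. The chain rule then needs only the differential \<open>S'\<close> of
  \<open>S\<close> at \<open>z\<close>.\<close>

lemma pmp_hamiltonian_has_derivative:
  "(pmp_hamiltonian (sphere_fields r \<rho> h c) has_derivative
     (\<lambda>v. sphere_gradient r \<rho> h c z \<bullet> v)) (at z)"
proof -
  define k where "k = r * \<rho> / (2 * h)"
  define S :: "config \<times> config \<Rightarrow> real" where
    "S = (\<lambda>((\<phi>, x), (\<gamma>, p)).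
       k * (p $ 1 * sin (c * (\<phi> $ 1 - \<phi> $ 2)) - p $ 2 * cos (c * (\<phi> $ 1 - \<phi> $ 2))))"
  obtain \<phi> x \<gamma> p where z: "z = ((\<phi>, x), (\<gamma>, p))" by (metis surj_pair)
  define s where "s = sin (c * (\<phi> $ 1 - \<phi> $ 2))"
  define q where "q = cos (c * (\<phi> $ 1 - \<phi> $ 2))"
  define S' :: "config \<times> config \<Rightarrow> real" where
    "S' = (\<lambda>((\<phi>', x'), (\<gamma>', p')).
       k * (p' $ 1 * s - p' $ 2 * q + c * (\<phi>' $ 1 - \<phi>' $ 2) * (p $ 1 * q + p $ 2 * s)))"
  have S': "(S has_derivative S') (at z)"
    unfolding S_def S'_def s_def q_def case_prod_unfold
    by (auto intro!: derivative_eq_intros simp: z fun_eq_iff algebra_simps)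
  have H: "pmp_hamiltonian (sphere_fields r \<rho> h c) =
      (\<lambda>z. 1 / 2 * ((fst (snd z) $ 1 - S z)\<^sup>2 + (fst (snd z) $ 2 - S z)\<^sup>2))"
    by (auto simp: fun_eq_iff pmp_hamiltonian_def u_star_def sum_2 dot_sphere_fields k_def S_def)
  have "(pmp_hamiltonian (sphere_fields r \<rho> h c) has_derivative
      (\<lambda>v. (\<gamma> $ 1 - S z) * (fst (snd v) $ 1 - S' v) + (\<gamma> $ 2 - S z) * (fst (snd v) $ 2 - S' v)))
      (at z)"
    unfolding H
    by (rule derivative_eq_intros S' refl)+ (simp add: z fun_eq_iff algebra_simps)
  also have "(\<lambda>v. (\<gamma> $ 1 - S z) * (fst (snd v) $ 1 - S' v) + (\<gamma> $ 2 - S z) * (fst (snd v) $ 2 - S' v))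
      = (\<lambda>v. sphere_gradient r \<rho> h c z \<bullet> v)"
    unfolding z sphere_gradient_def Let_def u_star_def dot_sphere_fields dot_sphere_fields'_def
      sphere_fields_def case_prod_conv k_def[symmetric] S_def S'_def s_def[symmetric] q_def[symmetric]
    by (simp add: fun_eq_iff inner_prod_def inner_vec_def sum_2 algebra_simps)
  finally show ?thesis .
qed

lemma continuous_on_vector_2:
  fixes f g :: "'a::topological_space \<Rightarrow> real"
  assumes "continuous_on S f" "continuous_on S g"
  shows "continuous_on S (\<lambda>x. vector [f x, g x] :: real ^ 2)"
proof -
  have "(\<lambda>x. vector [f x, g x] :: real ^ 2) = (\<lambda>x. \<chi> i. if i = 1 then f x else g x)"
    by (auto simp: fun_eq_iff vec_eq_iff forall_2)
  moreover have "continuous_on S \<dots>"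
  proof (rule continuous_on_vec_lambda)
    show "continuous_on S (\<lambda>x. if i = 1 then f x else g x)" for i :: 2
      using assms by (cases "i = 1") simp_all
  qed
  ultimately show ?thesis by (simp only:)
qed

lemma continuous_on_sphere_gradient: "continuous_on S (sphere_gradient r \<rho> h c)"
proof -
  have \<phi>: "continuous_on S (\<lambda>z :: config \<times> config. c * (fst (fst z) $ 1 - fst (fst z) $ 2))"
    by (intro continuous_intros)
  have costates: "continuous_on S (\<lambda>z :: config \<times> config. fst (snd z) $ i)"
      "continuous_on S (\<lambda>z :: config \<times> config. snd (snd z) $ i)" for i
    by (intro continuous_intros)+
  note trig = continuous_on_sin[OF \<phi>] continuous_on_cos[OF \<phi>]
  have u: "continuous_on S (\<lambda>z. u_star (sphere_fields r \<rho> h c) z i)" for i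
    unfolding u_star_def case_prod_unfold dot_sphere_fields
    by (intro continuous_on_diff continuous_on_mult_left continuous_on_mult costates trig)
  have m: "continuous_on S (\<lambda>z. dot_sphere_fields' r \<rho> h c (fst (fst z)) (snd (snd z)))"
    unfolding dot_sphere_fields'_def
    by (intro continuous_on_add continuous_on_mult_left continuous_on_mult costates trig)
  have A: "continuous_on S (\<lambda>z :: config \<times> config. sphere_fields r \<rho> h c i (fst (fst z)))" for i
    unfolding sphere_fields_def
    by (intro continuous_on_scaleR continuous_on_vector_2 continuous_on_const continuous_on_minus trig)
  show ?thesis
    unfolding sphere_gradient_def Let_def case_prod_unfold prod.collapse
    by (intro continuous_on_Pair continuous_on_vector_2 continuous_on_scaleR continuous_on_minus
        continuous_on_add continuous_on_mult continuous_on_const u m A)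
qed

section \<open>The linear first integrals and complete integrability\<close>

lemma sum_costates_has_derivative:
  "((\<lambda>((\<phi>, x), (\<gamma>, p)). \<gamma> $ 1 + \<gamma> $ 2) has_derivative
     (\<lambda>v. (((0, 0), (vector [1, 1], 0)) :: config \<times> config) \<bullet> v)) (at z)"
  unfolding case_prod_unfold
  by (rule derivative_eq_intros refl)+ (auto simp: inner_prod_def inner_vec_def sum_2)

lemma momentum_has_derivative:
  "((\<lambda>((\<phi>, x), (\<gamma>, p)). p $ i) has_derivative
     (\<lambda>v. (((0, 0), (0, axis i 1)) :: config \<times> config) \<bullet> v)) (at z)"
  unfolding case_prod_unfold
  by (rule derivative_eq_intros refl)+ (auto simp: inner_prod_def inner_axis')

text \<open>The set is the complement of a hyperplane with normal \<open>n\<close>, and a hyperplane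
  is closed with empty interior.\<close>

lemma open_dense_costates_neq:
  defines "U \<equiv> {((\<phi>, x), (\<gamma>, p)). \<gamma> $ 1 \<noteq> \<gamma> $ 2} :: (config \<times> config) set"
  shows "open U" "closure U = UNIV"
proof -
  define n :: "config \<times> config" where "n = ((0, 0), (vector [1, -1], 0))"
  have "(vector [1, -1] :: real ^ 2) \<noteq> 0" by (auto simp: vec_eq_iff forall_2)
  then have n: "n \<noteq> 0" by (simp add: n_def prod_eq_iff)
  have U: "U = - {z. n \<bullet> z = 0}"
    by (auto simp: U_def n_def inner_vec_def sum_2)
  show "open U" unfolding U using closed_hyperplane by blast
  show "closure U = UNIV" unfolding U closure_complement interior_hyperplane[OF n] by simp
qed

text \<open>All brackets are read off from explicit gradients. In the one of
  \<open>\<gamma>\<^sub>1 + \<gamma>\<^sub>2\<close> with \<open>H\<close>, the opposite angle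
  entries of the gradient of \<open>H\<close> cancel; brackets of \<open>p\<close> with
  \<open>H\<close> vanish because \<open>x\<close> is cyclic.\<close>

theorem sphere_completely_integrable:
  fixes r \<rho> h c :: real
  defines "H \<equiv> pmp_hamiltonian (sphere_fields r \<rho> h c)"
  shows "completely_integrable_by H
       [H, \<lambda>((\<phi>, x), (\<gamma>, p)). \<gamma> $ 1 + \<gamma> $ 2,
        \<lambda>((\<phi>, x), (\<gamma>, p)). p $ 1, \<lambda>((\<phi>, x), (\<gamma>, p)). p $ 2]"
    (is "completely_integrable_by H [H, ?S, ?P1, ?P2]")
proof -
  note dH = pmp_hamiltonian_has_derivative[of r \<rho> h c, folded H_def]
  note dS = sum_costates_has_derivative and dP = momentum_has_derivative
  have bracket: "\<forall>F\<in>{H, ?S, ?P1, ?P2}. \<forall>G\<in>{H, ?S, ?P1, ?P2}. \<forall>z. poisson_bracket F G z = 0"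
    by (auto simp: poisson_bracket_eq[OF dH dH] poisson_bracket_eq[OF dH dS]
        poisson_bracket_eq[OF dH dP] poisson_bracket_eq[OF dS dH] poisson_bracket_eq[OF dS dS]
        poisson_bracket_eq[OF dS dP] poisson_bracket_eq[OF dP dH] poisson_bracket_eq[OF dP dS]
        poisson_bracket_eq[OF dP dP] sphere_gradient_def Let_def inner_vec_def sum_2)
  have "cont_diff H" "cont_diff ?S" "cont_diff ?P1" "cont_diff ?P2"
    by (rule cont_diff_if_gradient[OF dH] cont_diff_if_gradient[OF dS]
        cont_diff_if_gradient[OF dP] continuous_on_sphere_gradient continuous_on_const)+
  moreover have "first_integral H H" "first_integral H ?S" "first_integral H ?P1"
      "first_integral H ?P2"
    by (intro first_integral_if_gradient[OF dH dH] first_integral_if_gradient[OF dS dH]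
        first_integral_if_gradient[OF dP dH];
        use bracket in \<open>simp del: split_paired_All\<close>)+
  moreover have "functionally_independent [H, ?S, ?P1, ?P2]"
    unfolding functionally_independent_def
  proof (intro exI conjI ballI allI impI)
    let ?U = "{((\<phi>, x), (\<gamma>, p)). \<gamma> $ 1 \<noteq> \<gamma> $ 2} :: (config \<times> config) set"
    show "open ?U" "closure ?U = UNIV" by (fact open_dense_costates_neq)+
    fix z k i
    assume z: "z \<in> ?U" and i: "i < length [H, ?S, ?P1, ?P2]"
      and "\<forall>v. (\<Sum>i<length [H, ?S, ?P1, ?P2].
            k i * frechet_derivative ([H, ?S, ?P1, ?P2] ! i) (at z) v) = 0"
    then have lin: "k 0 * (sphere_gradient r \<rho> h c z \<bullet> v)
        + k 1 * (((0, 0), (vector [1, 1], 0)) \<bullet> v)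
        + k 2 * (((0, 0), (0, axis 1 1)) \<bullet> v) + k 3 * (((0, 0), (0, axis 2 1)) \<bullet> v) = 0" for v
      using frechet_derivative_at[OF dH, of z] frechet_derivative_at[OF dS, of z]
        frechet_derivative_at[OF dP, of 1 z] frechet_derivative_at[OF dP, of 2 z]
      by (simp add: numeral_3_eq_3 numeral_2_eq_2 del: split_paired_All)
    \<comment> \<open>The costate direction (1, -1) annihilates the three linear differentials,
      while that of \<open>H\<close> takes the value
      \<open>\<gamma>\<^sub>1 - \<gamma>\<^sub>2\<close>, nonzero on the chosen set.\<close>
    have k0: "k 0 = 0"
      using lin[of "((0, 0), (vector [1, -1], 0))"] z
      by (auto simp: sphere_gradient_def Let_def inner_vec_def sum_2 u_star_def
          sphere_fields_def)
    have "k 1 = 0" "k 2 = 0" "k 3 = 0"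
      using lin[of "((0, 0), (vector [1, 1], 0))"] lin[of "((0, 0), (0, axis 1 1))"]
        lin[of "((0, 0), (0, axis 2 1))"] k0
      by (simp_all add: inner_vec_def sum_2 axis_def)
    moreover have "i \<in> {0, 1, 2, 3}" using i by auto
    ultimately show "k i = 0" using k0 by auto
  qed
  ultimately show ?thesis
    using bracket by (simp add: completely_integrable_by_def)
qed


section \<open>Reduction to the pendulum\<close>

text \<open>Among the costates only the difference of the \<gamma>-components is tracked; their sum
  and \<open>p\<close> are first integrals.\<close>

lemma hamilton_solution_sphereD:
  fixes r \<rho> h c t :: real
  assumes "hamilton_solution (pmp_hamiltonian (sphere_fields r \<rho> h c)) I z"
    and "z = (\<lambda>t. ((\<phi> t, x t), (\<gamma> t, p t)))" and "t \<in> I"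
  defines "u \<equiv> u_star (sphere_fields r \<rho> h c) (z t)"
  shows "(\<phi> has_vector_derivative vector [u 1, u 2]) (at t within I)"
    and "(x has_vector_derivative - (u 1 + u 2) *\<^sub>R sphere_fields r \<rho> h c 1 (\<phi> t)) (at t within I)"
    and "((\<lambda>t. \<gamma> t $ 1 - \<gamma> t $ 2) has_real_derivative
            2 * c * dot_sphere_fields' r \<rho> h c (\<phi> t) (p t) * (u 1 + u 2)) (at t within I)"
proof -
  define m where "m = c * dot_sphere_fields' r \<rho> h c (\<phi> t) (p t) * (u 1 + u 2)"
  have D: "((\<lambda>t. ((\<phi> t, x t), (\<gamma> t, p t))) has_vector_derivative
      ((vector [u 1, u 2], - (u 1 + u 2) *\<^sub>R sphere_fields r \<rho> h c 1 (\<phi> t)),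
       (- vector [- m, m], 0))) (at t within I)"
    using assms(1,3) unfolding hamilton_solution_def
    by (auto simp: grad_q_eq[OF pmp_hamiltonian_has_derivative]
        grad_p_eq[OF pmp_hamiltonian_has_derivative] sphere_gradient_def Let_def
        assms(2) u_def m_def)
  note D1 = bounded_linear.has_vector_derivative[OF bounded_linear_fst D, simplified]
  note D2 = bounded_linear.has_vector_derivative[OF bounded_linear_snd D, simplified]
  show "(\<phi> has_vector_derivative vector [u 1, u 2]) (at t within I)"
    using bounded_linear.has_vector_derivative[OF bounded_linear_fst D1] by simp
  show "(x has_vector_derivative - (u 1 + u 2) *\<^sub>R sphere_fields r \<rho> h c 1 (\<phi> t)) (at t within I)"
    using bounded_linear.has_vector_derivative[OF bounded_linear_snd D1] by simp
  have \<gamma>: "(\<gamma> has_vector_derivative - vector [- m, m]) (at t within I)"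
    using bounded_linear.has_vector_derivative[OF bounded_linear_fst D2] by simp
  show "((\<lambda>t. \<gamma> t $ 1 - \<gamma> t $ 2) has_real_derivative
            2 * c * dot_sphere_fields' r \<rho> h c (\<phi> t) (p t) * (u 1 + u 2)) (at t within I)"
    using has_vector_derivative_diff[OF
        bounded_linear.has_vector_derivative[OF bounded_linear_vec_nth[of 1] \<gamma>]
        bounded_linear.has_vector_derivative[OF bounded_linear_vec_nth[of 2] \<gamma>]]
    by (simp add: has_real_derivative_iff_has_vector_derivative m_def algebra_simps)
qed

section \<open>The half-angle substitution\<close>

lemma tan_half_eq_sin_over_one_plus_cos: "tan (x / 2) = sin x / (1 + cos x)" for x :: real
  using tan_half[of "x / 2"] by (simp add: add.commute)

lemma one_plus_cos_pos:
  fixes x :: real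
  assumes "- pi < x" "x < pi"
  shows "1 + cos x > 0"
proof -
  have "cos (x / 2) > 0" using assms by (intro cos_gt_zero_pi) auto
  then show ?thesis using cos_double_cos[of "x / 2"] by simp
qed

lemma arctan_tan_half:
  assumes "- pi < x" "x < pi"
  shows "2 * arctan (tan (x / 2)) = x"
  using arctan_tan[of "x / 2"] assms by simp

text \<open>
  The parameters are \<open>e = sqrt E\<close>, \<open>C = cos \<theta>\<close>, \<open>q = (half_angle_factor a E \<sigma> * tan (\<theta> / 2))\<^sup>2\<close>, and
  \<open>m = \<theta>' / (2 c)\<close>; the left-hand side of the conclusion is \<open>(\<psi>' / c)\<^sup>2\<close> and the fraction on the
  right is \<open>cos \<psi>\<close>.
\<close>

lemma pendulum_identity:
  fixes a e \<sigma> C m q :: real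
  assumes P: "a - 2 * (e - \<sigma>) > 0" and e: "e > 0" and C: "1 + C > 0" "C \<le> 1"
    and m: "m\<^sup>2 + (\<sigma> - e * C)\<^sup>2 = a\<^sup>2 / 4"
    and q: "q = (a + 2 * (e + \<sigma>)) / (a - 2 * (e - \<sigma>)) * ((1 - C) / (1 + C))"
  shows "16 * m\<^sup>2 * ((a + 2 * (e + \<sigma>)) / (a - 2 * (e - \<sigma>))) / ((1 + C) * (1 + q))\<^sup>2
     = a\<^sup>2 + 4 * (e\<^sup>2 - \<sigma>\<^sup>2) + 4 * a * e * ((1 - q) / (1 + q))"
proof -
  define P where "P = a - 2 * (e - \<sigma>)"
  define Q where "Q = a + 2 * (e + \<sigma>)"
  \<comment> \<open>\<open>N\<close> is the common denominator: up to the factor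
    \<open>P * (1 + C) / 2\<close> it is \<open>1 + q\<close>, and it is also a factor of
    \<open>4 * m\<^sup>2\<close>, so one power of it will cancel.\<close>
  define N where "N = a + 2 * \<sigma> - 2 * e * C"
  have pos: "P > 0" "Q > 0" using P e by (auto simp: P_def Q_def)
  have "N = P + 2 * e * (1 - C)" by (simp add: N_def P_def algebra_simps)
  then have N: "N > 0" using pos e C by (simp add: add_pos_nonneg)
  have q': "q = Q * (1 - C) / (P * (1 + C))" by (simp add: q P_def Q_def)
  have "P * (1 + C) \<noteq> 0" using pos C by simp
  then have q1: "1 + q = 2 * N / (P * (1 + C))"
    unfolding q' by (simp add: divide_simps) (simp add: P_def Q_def N_def algebra_simps)
  have q2: "1 - q = 2 * (C * (a + 2 * \<sigma>) - 2 * e) / (P * (1 + C))"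
    using \<open>P * (1 + C) \<noteq> 0\<close>
    unfolding q' by (simp add: divide_simps) (simp add: P_def Q_def algebra_simps)
  have cos: "(1 - q) / (1 + q) = (C * (a + 2 * \<sigma>) - 2 * e) / N"
    unfolding q1 q2 using pos C N by (simp add: divide_simps)
  have c1: "(1 + C) * (1 + q) = 2 * N / P" unfolding q1 using pos C by (simp add: divide_simps)
  \<comment> \<open>Factor \<open>a\<^sup>2 - 4 * (\<sigma> - e * C)\<^sup>2\<close> as a difference
    of squares.\<close>
  have m4: "4 * m\<^sup>2 = (a - 2 * \<sigma> + 2 * e * C) * N"
    using m unfolding N_def by algebra
  have "16 * m\<^sup>2 * (Q / P) / ((1 + C) * (1 + q))\<^sup>2 = 4 * m\<^sup>2 * (P * Q) / N\<^sup>2"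
    unfolding c1 using pos N by (simp add: divide_simps power2_eq_square)
  also have "\<dots> = (a - 2 * \<sigma> + 2 * e * C) * (P * Q) / N"
    unfolding m4 using N by (simp add: divide_simps power2_eq_square)
  also have "\<dots> = a\<^sup>2 + 4 * (e\<^sup>2 - \<sigma>\<^sup>2) + 4 * a * e * ((C * (a + 2 * \<sigma>) - 2 * e) / N)"
    using N by (simp add: divide_simps)
      (simp add: P_def Q_def N_def power2_eq_square algebra_simps)
  finally show ?thesis unfolding cos P_def Q_def .
qed

text \<open>Differentiability of \<theta> is not assumed, only that of its sine and cosine. This
  suffices, since tan(\<theta>/2) is sin \<theta> / (1 + cos \<theta>), which makes \<psi> an
  explicit function of the two.\<close>

lemma pendulum_equation:
  fixes \<theta> \<psi> :: "real \<Rightarrow> real" and a E \<sigma> c m :: real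
  assumes E: "E > 0" and P: "a - 2 * (sqrt E - \<sigma>) > 0" and t: "t \<in> S"
    and \<theta>: "\<And>t. t \<in> S \<Longrightarrow> - pi < \<theta> t \<and> \<theta> t < pi"
    and \<psi>: "\<And>t. t \<in> S \<Longrightarrow> - pi < \<psi> t \<and> \<psi> t < pi"
    and tan: "\<And>t. t \<in> S \<Longrightarrow> tan (\<psi> t / 2) = half_angle_factor a E \<sigma> * tan (\<theta> t / 2)"
    and y: "((\<lambda>t. 2 * sqrt E * sin (\<theta> t)) has_real_derivative
              2 * c * m * (2 * sqrt E * cos (\<theta> t))) (at t within S)"
    and w: "((\<lambda>t. 2 * sqrt E * cos (\<theta> t)) has_real_derivative
              - (2 * c * m * (2 * sqrt E * sin (\<theta> t)))) (at t within S)"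
    and m: "m\<^sup>2 + (\<sigma> - sqrt E * cos (\<theta> t))\<^sup>2 = a\<^sup>2 / 4"
  shows "\<exists>d. (\<psi> has_real_derivative d) (at t within S) \<and>
             d\<^sup>2 = c\<^sup>2 * (a\<^sup>2 + 4 * (E - \<sigma>\<^sup>2) + 4 * a * sqrt E * cos (\<psi> t))"
proof -
  define f where "f = half_angle_factor a E \<sigma>"
  define C where "C = cos (\<theta> t)"
  define Sn where "Sn = sin (\<theta> t)"
  have e: "sqrt E > 0" using E by simp
  have pos: "1 + cos (\<theta> s) > 0" if "s \<in> S" for s
    using that \<theta> one_plus_cos_pos by blast
  have Cpos: "1 + C > 0" using pos[OF t] by (simp add: C_def)
  have CS: "Sn\<^sup>2 = 1 - C\<^sup>2" by (simp add: Sn_def C_def sin_squared_eq)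
  have \<psi>_eq: "\<psi> s = 2 * arctan (f * (sin (\<theta> s) / (1 + cos (\<theta> s))))" if "s \<in> S" for s
    using arctan_tan_half[of "\<psi> s"] \<psi>[OF that] tan[OF that]
    by (simp add: f_def tan_half_eq_sin_over_one_plus_cos)
  have sin': "((\<lambda>s. sin (\<theta> s)) has_real_derivative 2 * c * m * C) (at t within S)"
    using DERIV_cdivide[OF y, of "2 * sqrt E"] e by (simp add: C_def mult.assoc)
  have cos': "((\<lambda>s. cos (\<theta> s)) has_real_derivative - (2 * c * m * Sn)) (at t within S)"
    using DERIV_cdivide[OF w, of "2 * sqrt E"] e by (simp add: Sn_def mult.assoc)
  have "((\<lambda>s. sin (\<theta> s) / (1 + cos (\<theta> s))) has_real_derivative
      (2 * c * m * C * (1 + C) - Sn * - (2 * c * m * Sn)) / ((1 + C) * (1 + C))) (at t within S)"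
    using DERIV_divide[OF sin' DERIV_add[OF DERIV_const[of 1] cos']] pos[OF t]
    by (simp add: C_def Sn_def)
  also have "(2 * c * m * C * (1 + C) - Sn * - (2 * c * m * Sn)) = 2 * c * m * (1 + C)"
    \<comment> \<open>The Pythagorean identity collapses \<open>C * (1 + C) + Sn\<^sup>2\<close> to
      \<open>1 + C\<close>.\<close>
    using CS by algebra
  finally have T': "((\<lambda>s. sin (\<theta> s) / (1 + cos (\<theta> s))) has_real_derivative
      2 * c * m / (1 + C)) (at t within S)"
    using Cpos by simp
  define q where "q = (f * (Sn / (1 + C)))\<^sup>2"
  have D: "((\<lambda>s. 2 * arctan (f * (sin (\<theta> s) / (1 + cos (\<theta> s))))) has_real_derivative
      2 * (f * (2 * c * m / (1 + C)) / (1 + q))) (at t within S)"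
    by (rule derivative_eq_intros T' refl)+
      (simp add: q_def C_def Sn_def divide_inverse mult_ac)
  \<comment> \<open>The formula for \<psi> holds on all of \<open>S\<close>, so the radius 1 is
    arbitrary.\<close>
  have \<psi>': "(\<psi> has_real_derivative 2 * (f * (2 * c * m / (1 + C)) / (1 + q))) (at t within S)"
    by (rule has_field_derivative_transform_within[OF D zero_less_one t]) (simp add: \<psi>_eq)
  have f2: "f\<^sup>2 = (a + 2 * (sqrt E + \<sigma>)) / (a - 2 * (sqrt E - \<sigma>))"
    unfolding f_def half_angle_factor_def
    \<comment> \<open>The numerator exceeds the positive denominator by \<open>4 * sqrt E\<close>,
      so the radicand is nonnegative.\<close>
    by (rule real_sqrt_pow2, rule divide_nonneg_nonneg) (use P e in argo)+
  have "(Sn / (1 + C))\<^sup>2 = (1 - C) / (1 + C)"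
    using Cpos unfolding power_divide CS by (simp add: divide_simps) algebra
  then have q: "q = (a + 2 * (sqrt E + \<sigma>)) / (a - 2 * (sqrt E - \<sigma>)) * ((1 - C) / (1 + C))"
    unfolding q_def power_mult_distrib f2 by simp
  have "cos (\<psi> t) = (1 - q) / (1 + q)"
  proof -
    have "q = (tan (\<psi> t / 2))\<^sup>2"
      by (simp add: q_def tan[OF t] tan_half_eq_sin_over_one_plus_cos[of "\<theta> t"] f_def Sn_def C_def)
    moreover have "cos (\<psi> t / 2) \<noteq> 0" using \<psi>[OF t] cos_gt_zero_pi[of "\<psi> t / 2"] by auto
    ultimately show ?thesis using cos_tan_half[of "\<psi> t / 2"] by simp
  qed
  moreover have "(2 * (f * (2 * c * m / (1 + C)) / (1 + q)))\<^sup>2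
      = c\<^sup>2 * (16 * m\<^sup>2 * f\<^sup>2 / ((1 + C) * (1 + q))\<^sup>2)"
    by (simp add: power_mult_distrib power_divide)
  moreover have "16 * m\<^sup>2 * f\<^sup>2 / ((1 + C) * (1 + q))\<^sup>2
      = a\<^sup>2 + 4 * ((sqrt E)\<^sup>2 - \<sigma>\<^sup>2) + 4 * a * sqrt E * ((1 - q) / (1 + q))"
    unfolding f2 using pendulum_identity[OF P e Cpos _ _ q] m by (simp add: C_def)
  ultimately show ?thesis using \<psi>' E by auto
qed

text \<open>The factor is positive, so the half-angle relation can be divided by it, and arctan
  inverts tan on (-pi/2, pi/2).\<close>

lemma theta_of_pendulum_eq:
  assumes "E > 0" "a - 2 * (sqrt E - \<sigma>) > 0" "- pi < \<theta>" "\<theta> < pi"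
    and "tan (\<psi> / 2) = half_angle_factor a E \<sigma> * tan (\<theta> / 2)"
  shows "\<theta> = theta_of_pendulum a E \<sigma> \<psi>"
proof -
  have "sqrt E > 0" using assms(1) by simp
  then have "half_angle_factor a E \<sigma> > 0"
    unfolding half_angle_factor_def
    by (intro real_sqrt_gt_zero divide_pos_pos) (use assms(2) in argo)+
  then show ?thesis
    using assms arctan_tan_half[of \<theta>] by (simp add: theta_of_pendulum_def)
qed

section \<open>Pendulum equation and quadratures along a solution\<close>

theorem theorem6p1:
  fixes r \<rho> w h Is J c :: real and A :: fields
  assumes "r > 0" "\<rho> > 0" "w > 0" "h > 0" "Is > 0" "J > 0"
    and c_def: "c = \<rho> * Is / (2 * w * (Is + J))"
    and A_def: "A = sphere_fields r \<rho> h c"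
  shows
    "completely_integrable_by (pmp_hamiltonian A)
       [pmp_hamiltonian A,
        \<lambda>((\<phi>, x), (\<gamma>, p)). \<gamma> $ 1 + \<gamma> $ 2,
        \<lambda>((\<phi>, x), (\<gamma>, p)). p $ 1,
        \<lambda>((\<phi>, x), (\<gamma>, p)). p $ 2]
     \<and>
     (\<forall>T \<phi>0 x0 xT u \<phi> x \<gamma> p z E a \<sigma>.
        0 < T \<longrightarrow>
        ocp_optimal A T \<phi>0 x0 xT u \<phi> x \<longrightarrow>
        z = (\<lambda>t. ((\<phi> t, x t), (\<gamma> t, p t))) \<longrightarrow>
        hamilton_solution (pmp_hamiltonian A) {0..T} z \<longrightarrow>
        E = pmp_hamiltonian A (z 0) \<longrightarrow>
        a = r * \<rho> / h * norm (p 0) \<longrightarrow>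
        \<sigma> = (\<gamma> 0 $ 1 + \<gamma> 0 $ 2) / 2 \<longrightarrow>
        a - 2 * (sqrt E - \<sigma>) > 0 \<longrightarrow>
          (E = 0 \<longrightarrow> (\<forall>t\<in>{0..T}. \<phi> t = \<phi> 0 \<and> x t = x 0)) \<and>
          (E > 0 \<longrightarrow>
            (\<forall>t0 t1 \<theta> \<psi>.
               0 \<le> t0 \<longrightarrow> t0 < t1 \<longrightarrow> t1 \<le> T \<longrightarrow>
               (\<forall>t\<in>{t0..t1}.
                  - pi < \<theta> t \<and> \<theta> t < pi \<and>
                  u_star A (z t) 1 + u_star A (z t) 2 = 2 * sqrt E * cos (\<theta> t) \<and>
                  u_star A (z t) 1 - u_star A (z t) 2 = 2 * sqrt E * sin (\<theta> t) \<and>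
                  - pi < \<psi> t \<and> \<psi> t < pi \<and>
                  tan (\<psi> t / 2) = half_angle_factor a E \<sigma> * tan (\<theta> t / 2)) \<longrightarrow>
               (\<forall>t\<in>{t0..t1}.
                  (\<exists>d. (\<psi> has_real_derivative d) (at t within {t0..t1}) \<and>
                       d\<^sup>2 = c\<^sup>2 * (a\<^sup>2 + 4 * (E - \<sigma>\<^sup>2) + 4 * a * sqrt E * cos (\<psi> t))) \<and>
                  \<theta> t = theta_of_pendulum a E \<sigma> (\<psi> t) \<and>
                  ((\<lambda>s. 2 * sqrt E * cos (theta_of_pendulum a E \<sigma> (\<psi> s)))
                     has_integral ((\<phi> t $ 1 + \<phi> t $ 2) - (\<phi> t0 $ 1 + \<phi> t0 $ 2))) {t0..t} \<and>
                  ((\<lambda>s. 2 * sqrt E * sin (theta_of_pendulum a E \<sigma> (\<psi> s)))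
                     has_integral ((\<phi> t $ 1 - \<phi> t $ 2) - (\<phi> t0 $ 1 - \<phi> t0 $ 2))) {t0..t} \<and>
                  ((\<lambda>s. - (2 * sqrt E * cos (theta_of_pendulum a E \<sigma> (\<psi> s))) *\<^sub>R A 1 (\<phi> s))
                     has_integral (x t - x t0)) {t0..t}))))"
proof (intro conjI allI impI ballI)
  let ?H = "pmp_hamiltonian A"
  let ?S = "\<lambda>((\<phi>, x), (\<gamma>, p)). \<gamma> $ 1 + \<gamma> $ 2 :: real"
  show integrable: "completely_integrable_by ?H
       [?H, ?S, \<lambda>((\<phi>, x), (\<gamma>, p)). p $ 1, \<lambda>((\<phi>, x), (\<gamma>, p)). p $ 2]"
    unfolding A_def by (rule sphere_completely_integrable)
  fix T :: real and \<phi>0 x0 xT :: "real ^ 2" and u \<phi> x \<gamma> p :: "real \<Rightarrow> real ^ 2"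
    and z :: "real \<Rightarrow> config \<times> config" and E a \<sigma> :: real
  assume "0 < T" and z_eq: "z = (\<lambda>t. ((\<phi> t, x t), (\<gamma> t, p t)))"
    and sol: "hamilton_solution ?H {0..T} z"
    and E: "E = ?H (z 0)" and a: "a = r * \<rho> / h * norm (p 0)"
    and \<sigma>: "\<sigma> = (\<gamma> 0 $ 1 + \<gamma> 0 $ 2) / 2" and P: "a - 2 * (sqrt E - \<sigma>) > 0"
  define U where "U t = u_star A (z t)" for t
  define M where "M t = dot_sphere_fields' r \<rho> h c (\<phi> t) (p t)" for t
  note ham = hamilton_solution_sphereD[OF sol[unfolded A_def] z_eq, folded A_def, folded U_def M_def]
  \<comment> \<open>The integrability just shown supplies the conservation laws along the given
    solution.\<close>
  have first: "F (z t) = F (z 0)" if "t \<in> {0..T}"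
    and "F \<in> {?H, ?S, \<lambda>((\<phi>, x), (\<gamma>, p)). p $ 1, \<lambda>((\<phi>, x), (\<gamma>, p)). p $ 2}" for F t
    using integrable that sol first_integralD[of ?H F 0 T z t]
    unfolding completely_integrable_by_def by auto
  have H_const: "?H (z t) = E" if "t \<in> {0..T}" for t using first[OF that] E by simp
  have \<sigma>_const: "\<gamma> t $ 1 + \<gamma> t $ 2 = 2 * \<sigma>" if "t \<in> {0..T}" for t
    using first[OF that, of ?S] \<sigma> by (simp add: z_eq)
  have p_const: "p t = p 0" if "t \<in> {0..T}" for t
    using first[OF that, of "\<lambda>((\<phi>, x), (\<gamma>, p)). p $ 1"]
      first[OF that, of "\<lambda>((\<phi>, x), (\<gamma>, p)). p $ 2"]
    by (simp add: z_eq vec_eq_iff forall_2)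
  {
    fix t assume "E = 0" and t: "t \<in> {0..T}"
    \<comment> \<open>\<open>E\<close> is half a sum of two squares, so at zero energy both controls
      vanish and the configuration stays at rest.\<close>
    have "U s 1 = 0" "U s 2 = 0" if "s \<in> {0..T}" for s
      using H_const[OF that] \<open>E = 0\<close>
      by (simp_all add: pmp_hamiltonian_def sum_2 sum_power2_eq_zero_iff U_def)
    moreover have "vector [0, 0] = (0 :: real ^ 2)" by (simp add: vec_eq_iff forall_2)
    ultimately have "(\<phi> has_vector_derivative 0) (at s within {0..T})"
        "(x has_vector_derivative 0) (at s within {0..T})" if "s \<in> {0..T}" for s
      using ham[OF that] that by auto
    note zero = this
    obtain k where "\<And>s. s \<in> {0..T} \<Longrightarrow> \<phi> s = k"
      using has_vector_derivative_zero_constant[OF convex_real_interval(5) zero(1)] by blast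
    then have "\<phi> t = \<phi> 0" using t by simp
    moreover obtain l where "\<And>s. s \<in> {0..T} \<Longrightarrow> x s = l"
      using has_vector_derivative_zero_constant[OF convex_real_interval(5) zero(2)] by blast
    then have "x t = x 0" using t by simp
    ultimately have "\<phi> t = \<phi> 0 \<and> x t = x 0" ..
  }
  then show "\<phi> t = \<phi> 0" "x t = x 0" if "E = 0" "t \<in> {0..T}" for t using that by blast+

  fix t0 t1 :: real and \<theta> \<psi> :: "real \<Rightarrow> real" and t
  assume "E > 0" "0 \<le> t0" "t0 < t1" "t1 \<le> T" and t: "t \<in> {t0..t1}"
    and *: "\<forall>t\<in>{t0..t1}.
                  - pi < \<theta> t \<and> \<theta> t < pi \<and>
                  u_star A (z t) 1 + u_star A (z t) 2 = 2 * sqrt E * cos (\<theta> t) \<and>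
                  u_star A (z t) 1 - u_star A (z t) 2 = 2 * sqrt E * sin (\<theta> t) \<and>
                  - pi < \<psi> t \<and> \<psi> t < pi \<and>
                  tan (\<psi> t / 2) = half_angle_factor a E \<sigma> * tan (\<theta> t / 2)"
  have sub: "{t0..t1} \<subseteq> {0..T}" "{t0..t} \<subseteq> {0..T}"
    using \<open>0 \<le> t0\<close> \<open>t1 \<le> T\<close> t by auto
  have th: "- pi < \<theta> s" "\<theta> s < pi" "- pi < \<psi> s" "\<psi> s < pi"
      "U s 1 + U s 2 = 2 * sqrt E * cos (\<theta> s)" "U s 1 - U s 2 = 2 * sqrt E * sin (\<theta> s)"
      "tan (\<psi> s / 2) = half_angle_factor a E \<sigma> * tan (\<theta> s / 2)" if "s \<in> {t0..t1}" for s
    using * that by (auto simp: U_def)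
  have \<theta>_eq: "\<theta> s = theta_of_pendulum a E \<sigma> (\<psi> s)" if "s \<in> {t0..t1}" for s
    using theta_of_pendulum_eq[OF \<open>E > 0\<close> P] th[OF that] by blast
  then show "\<theta> t = theta_of_pendulum a E \<sigma> (\<psi> t)" using t .

  \<comment> \<open>The scalar subtracted from both costates cancels in the difference of the
    controls and doubles in their sum.\<close>
  have diff: "\<gamma> s $ 1 - \<gamma> s $ 2 = U s 1 - U s 2" for s
    by (simp add: U_def u_star_def z_eq A_def dot_sphere_fields)
  have sum: "U s 1 + U s 2 = 2 * \<sigma> - 2 * (p 0 \<bullet> A 1 (\<phi> s))" if "s \<in> {0..T}" for s
    using \<sigma>_const[OF that] p_const[OF that]
    by (simp add: U_def u_star_def z_eq A_def dot_sphere_fields)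
  have \<phi>': "((\<lambda>t. \<phi> t $ i) has_real_derivative U s i) (at s within {0..T})" if "s \<in> {0..T}" for s i
    using bounded_linear.has_vector_derivative[OF bounded_linear_vec_nth[of i] ham(1)[OF that]]
      exhaust_2[of i]
    by (auto simp: has_real_derivative_iff_has_vector_derivative)

  show "\<exists>d. (\<psi> has_real_derivative d) (at t within {t0..t1}) \<and>
          d\<^sup>2 = c\<^sup>2 * (a\<^sup>2 + 4 * (E - \<sigma>\<^sup>2) + 4 * a * sqrt E * cos (\<psi> t))"
  proof (rule pendulum_equation[where m = "M t", OF \<open>E > 0\<close> P t])
    have t': "t \<in> {0..T}" using sub t by blast
    have "((\<lambda>s. U s 1 - U s 2) has_real_derivative 2 * c * M t * (U t 1 + U t 2))
        (at t within {t0..t1})"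
      using DERIV_subset[OF ham(3)[OF t'] sub(1)] by (simp add: diff)
    then have "((\<lambda>s. U s 1 - U s 2) has_real_derivative
        2 * c * M t * (2 * sqrt E * cos (\<theta> t))) (at t within {t0..t1})"
      by (simp only: th(5)[OF t])
    then show "((\<lambda>t. 2 * sqrt E * sin (\<theta> t)) has_real_derivative
        2 * c * M t * (2 * sqrt E * cos (\<theta> t))) (at t within {t0..t1})"
      by (rule has_field_derivative_transform_within[OF _ zero_less_one t]) (simp add: th)
    \<comment> \<open>Differentiating the expression in \<open>sum\<close> needs only the angle
      equations, as \<sigma> and \<open>p\<close> are constant.\<close>
    have "((\<lambda>s. 2 * \<sigma> - 2 * (p 0 \<bullet> A 1 (\<phi> s))) has_real_derivative
        - (2 * c * M t * (U t 1 - U t 2))) (at t within {t0..t1})"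
      unfolding A_def dot_sphere_fields
      by (rule derivative_eq_intros DERIV_subset[OF \<phi>'[OF t'] sub(1)] refl)+
        (simp add: M_def dot_sphere_fields'_def p_const[OF t'] algebra_simps diff_divide_distrib)
    then have "((\<lambda>s. 2 * \<sigma> - 2 * (p 0 \<bullet> A 1 (\<phi> s))) has_real_derivative
        - (2 * c * M t * (2 * sqrt E * sin (\<theta> t)))) (at t within {t0..t1})"
      by (simp only: th(6)[OF t])
    then show "((\<lambda>t. 2 * sqrt E * cos (\<theta> t)) has_real_derivative
        - (2 * c * M t * (2 * sqrt E * sin (\<theta> t)))) (at t within {t0..t1})"
    proof (rule has_field_derivative_transform_within[OF _ zero_less_one t])
      fix s assume "s \<in> {t0..t1}"
      then show "2 * \<sigma> - 2 * (p 0 \<bullet> A 1 (\<phi> s)) = 2 * sqrt E * cos (\<theta> s)"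
        using th(5) sum sub(1) by (metis subsetD)
    qed
    have "\<sigma> - sqrt E * cos (\<theta> t) = p t \<bullet> A 1 (\<phi> t)"
      using sum[OF t'] th(5)[OF t] p_const[OF t'] by simp
    then show "(M t)\<^sup>2 + (\<sigma> - sqrt E * cos (\<theta> t))\<^sup>2 = a\<^sup>2 / 4"
      by (simp add: M_def A_def dot_sphere_fields_squares a p_const[OF t'])
  qed (use th in auto)

  have "t0 \<le> t" using t by simp
  \<comment> \<open>The integrands are the sum and difference of the controls, so the quadratures
    below are the fundamental theorem of calculus applied to the state equations.\<close>
  have recover: "2 * sqrt E * cos (theta_of_pendulum a E \<sigma> (\<psi> s)) = U s 1 + U s 2"
      "2 * sqrt E * sin (theta_of_pendulum a E \<sigma> (\<psi> s)) = U s 1 - U s 2"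
    if "s \<in> {t0..t}" for s
    using th(5,6)[of s] \<theta>_eq[of s] that t by auto
  have \<phi>'': "((\<lambda>t. \<phi> t $ i) has_real_derivative U s i) (at s within {t0..t})"
    if "s \<in> {t0..t}" for s i
    using DERIV_subset[OF \<phi>' sub(2)] sub(2) that by blast
  show "((\<lambda>s. 2 * sqrt E * cos (theta_of_pendulum a E \<sigma> (\<psi> s)))
      has_integral ((\<phi> t $ 1 + \<phi> t $ 2) - (\<phi> t0 $ 1 + \<phi> t0 $ 2))) {t0..t}"
    by (rule fundamental_theorem_of_calculus[OF \<open>t0 \<le> t\<close>, of "\<lambda>s. \<phi> s $ 1 + \<phi> s $ 2"])
      (simp only: recover has_real_derivative_iff_has_vector_derivative[symmetric] DERIV_add \<phi>'')
  show "((\<lambda>s. 2 * sqrt E * sin (theta_of_pendulum a E \<sigma> (\<psi> s)))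
      has_integral ((\<phi> t $ 1 - \<phi> t $ 2) - (\<phi> t0 $ 1 - \<phi> t0 $ 2))) {t0..t}"
    by (rule fundamental_theorem_of_calculus[OF \<open>t0 \<le> t\<close>, of "\<lambda>s. \<phi> s $ 1 - \<phi> s $ 2"])
      (simp only: recover has_real_derivative_iff_has_vector_derivative[symmetric] DERIV_diff \<phi>'')
  show "((\<lambda>s. - (2 * sqrt E * cos (theta_of_pendulum a E \<sigma> (\<psi> s))) *\<^sub>R A 1 (\<phi> s))
      has_integral (x t - x t0)) {t0..t}"
  proof (rule fundamental_theorem_of_calculus[OF \<open>t0 \<le> t\<close>])
    fix s assume s: "s \<in> {t0..t}"
    then have "(x has_vector_derivative - (U s 1 + U s 2) *\<^sub>R A 1 (\<phi> s)) (at s within {t0..t})"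
      using has_vector_derivative_within_subset[OF ham(2) sub(2)] sub(2) by blast
    then show "(x has_vector_derivative
        - (2 * sqrt E * cos (theta_of_pendulum a E \<sigma> (\<psi> s))) *\<^sub>R A 1 (\<phi> s)) (at s within {t0..t})"
      by (simp only: recover(1)[OF s])
  qed
qed

end
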